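(* Let $a,b\ge 1$ be integers, let $m=2^{a}3^{b}-1$ and $p=3m(m+1)+1$, and suppose that $p$ is prime. Then the following are equivalent: (i) $w_2=5$ is a valid Pocklington witness for $p$ at the prime $q=2$; (ii) $m\equiv 1$ or $3\pmod 5$; (iii) $a-b\equiv 1$ or $2\pmod 4$.
   Context: For $q\in\{2,3\}$ and $p=3m(m+1)+1$ with $m=2^a3^b-1$ (so that $6\mid p-1$), an integer $w$ is a valid Pocklington witness for $p$ at $q$ if $w^{p-1}\equiv 1\pmod p$ and $\gcd(w^{(p-1)/q}-1,\,p)=1$. For $p$ prime, a number $w$ coprime to $p$ is valid at $q=2$ exactly when $w$ is a quadratic non-residue modulo $p$. *)

theory Defs
  imports "HOL-Number_Theory.Number_Theory"
begin

text \<open>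
  The subtraction is on natural numbers; it never truncates because
  \<open>2 ^ a * 3 ^ b \<ge> 1\<close>.
\<close>
definition pock_m :: "nat \<Rightarrow> nat \<Rightarrow> nat" where
  "pock_m a b = 2 ^ a * 3 ^ b - 1"

definition pock_p :: "nat \<Rightarrow> nat \<Rightarrow> nat" where
  "pock_p a b = 3 * pock_m a b * (pock_m a b + 1) + 1"

text \<open>
  Used for \<open>p = pock_p a b\<close> with \<open>a, b \<ge> 1\<close> and \<open>q \<in> {2, 3}\<close>: then
  \<open>6\<close> divides \<open>p - 1\<close>, so \<open>(p - 1) div q\<close> is the exact quotient.
  The witness is an integer, so \<open>w ^ ((p - 1) div q) - 1\<close> is integer subtraction.
\<close>
definition valid_pocklington_witness :: "nat \<Rightarrow> nat \<Rightarrow> int \<Rightarrow> bool" where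
  "valid_pocklington_witness p q w \<longleftrightarrow>
     [w ^ (p - 1) = 1] (mod int p) \<and> gcd (w ^ ((p - 1) div q) - 1) (int p) = 1"

end

theory Submission
  imports Defs
begin

text \<open>
  For an odd prime \<open>p\<close>, Euler's criterion turns a valid witness at \<open>2\<close> into a quadratic
  non-residue: the half power of \<open>w\<close> is the Legendre symbol, which meets both witness
  conditions exactly when it is \<open>-1\<close> (\<open>valid_witness_two_iff_Legendre\<close>).
  Because \<open>5\<close> is \<open>1\<close> modulo \<open>4\<close>, reciprocity has no sign, so \<open>5\<close> is a non-residue modulo \<open>p\<close>
  if and only if \<open>p\<close> is \<open>2\<close> or \<open>3\<close> modulo \<open>5\<close> (\<open>Legendre_five_eq_minus_one_iff\<close>).
  Since \<open>p\<close> is a quadratic polynomial in \<open>m\<close>, this is a condition on \<open>m\<close> modulo \<open>5\<close>: as \<open>m\<close>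
  runs through \<open>0, 1, 2, 3, 4\<close>, \<open>p\<close> runs through \<open>1, 2, 4, 2, 1\<close>, which singles out \<open>1\<close> and \<open>3\<close>.

  Modulo \<open>5\<close>, the numbers \<open>2\<close> and \<open>3\<close> are inverse to each other, so
  \<open>m + 1 = 2 ^ a * 3 ^ b\<close> is the power of \<open>2\<close> with exponent \<open>a - b\<close>. As \<open>2\<close> has order \<open>4\<close>
  there, \<open>m + 1\<close> is \<open>2\<close> or \<open>4\<close> exactly when \<open>a - b\<close> is \<open>1\<close> or \<open>2\<close> modulo \<open>4\<close>
  (\<open>two_three_power_mod_five_iff\<close>).
\<close>

text \<open>
  With \<open>x\<close> the half power of \<open>w\<close>, the symbol \<open>0\<close> violates \<open>x\<^sup>2 = 1\<close>, the symbol \<open>1\<close> makes \<open>p\<close>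
  divide \<open>x - 1\<close>, and the symbol \<open>-1\<close> makes \<open>x - 1\<close> congruent to \<open>-2\<close>, a unit for odd \<open>p\<close>.
\<close>
lemma valid_witness_two_iff_Legendre:
  fixes p :: nat and w :: int
  assumes "prime p" and "2 < p"
  shows "valid_pocklington_witness p 2 w \<longleftrightarrow> Legendre w (int p) = -1"
proof -
  define x where "x = w ^ ((p - 1) div 2)"
  have prime_int: "prime (int p)" using assms(1) by simp
  have "odd p" using assms by (simp add: prime_odd_nat)
  then have half: "(p - 1) div 2 * 2 = p - 1" by simp
  have fermat: "w ^ (p - 1) = x\<^sup>2"
    unfolding x_def by (metis half power_mult)
  have euler: "[Legendre w (int p) = x] (mod int p)"
    unfolding x_def using euler_criterion[OF assms] .
  have not_dvd: "\<not> int p dvd 1" "\<not> int p dvd 2"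
    using assms(2) zdvd_imp_le[of "int p" 1] zdvd_imp_le[of "int p" 2] by auto
  have "coprime (x - 1) (int p) \<longleftrightarrow> \<not> int p dvd x - 1"
    using prime_imp_coprime[OF prime_int, of "x - 1"] not_dvd(1)
    by (auto simp: coprime_commute coprime_absorb_left)
  then have valid: "valid_pocklington_witness p 2 w \<longleftrightarrow>
      [x\<^sup>2 = 1] (mod int p) \<and> \<not> int p dvd x - 1"
    by (simp only: valid_pocklington_witness_def fermat x_def[symmetric] coprime_iff_gcd_eq_1)
  consider "Legendre w (int p) = 0" | "Legendre w (int p) = 1" | "Legendre w (int p) = -1"
    unfolding Legendre_def by metis
  then show ?thesis
  proof cases
    case 1
    then have "[x\<^sup>2 = 0\<^sup>2] (mod int p)"
      using euler by (intro cong_pow) (simp add: cong_sym)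
    then have "\<not> [x\<^sup>2 = 1] (mod int p)"
      using not_dvd(1) by (metis cong_0_iff cong_dvd_iff zero_power2)
    then show ?thesis using 1 valid by simp
  next
    case 2
    then have "int p dvd x - 1"
      using euler by (metis cong_iff_dvd_diff cong_sym)
    then show ?thesis using 2 valid by simp
  next
    case 3
    then have x: "[x = -1] (mod int p)" using euler by (simp add: cong_sym)
    then have "[x\<^sup>2 = (-1)\<^sup>2] (mod int p)" by (rule cong_pow)
    moreover have "\<not> int p dvd x - 1"
    proof
      assume "int p dvd x - 1"
      moreover have "int p dvd x + 1" using x by (simp add: cong_iff_dvd_diff)
      ultimately have "int p dvd (x + 1) - (x - 1)" by (rule dvd_diff[rotated])
      then show False using not_dvd(2) by simp
    qed
    ultimately show ?thesis using 3 valid by simp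
  qed
qed

lemma Legendre_mod_five_eq_minus_one_iff:
  fixes n :: int
  shows "Legendre n 5 = -1 \<longleftrightarrow> n mod 5 = 2 \<or> n mod 5 = 3"
proof -
  have square: "y\<^sup>2 mod 5 = 0 \<or> y\<^sup>2 mod 5 = 1 \<or> y\<^sup>2 mod 5 = 4" for y :: int
  proof -
    have "y mod 5 \<in> {0, 1, 2, 3, 4}" by auto
    then have "(y mod 5)\<^sup>2 mod 5 \<in> {0, 1, 4}" by auto
    then show ?thesis by (simp add: power_mod)
  qed
  have "QuadRes 5 n \<longleftrightarrow> n mod 5 = 0 \<or> n mod 5 = 1 \<or> n mod 5 = 4"
  proof
    assume "QuadRes 5 n"
    then show "n mod 5 = 0 \<or> n mod 5 = 1 \<or> n mod 5 = 4"
      unfolding QuadRes_def cong_def using square by metis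
  next
    assume "n mod 5 = 0 \<or> n mod 5 = 1 \<or> n mod 5 = 4"
    then have "[0\<^sup>2 = n] (mod 5) \<or> [1\<^sup>2 = n] (mod 5) \<or> [2\<^sup>2 = n] (mod 5)"
      by (auto simp: cong_def)
    then show "QuadRes 5 n" unfolding QuadRes_def by blast
  qed
  then show ?thesis by (auto simp: Legendre_def cong_def)
qed

text \<open>
  The sign in the reciprocity law is trivial because \<open>(5 - 1) div 2\<close> is even, so the two symbols
  agree, and the squares modulo \<open>5\<close> are known.
\<close>
lemma Legendre_five_eq_minus_one_iff:
  fixes p :: nat
  assumes "prime p" and "2 < p" and "p \<noteq> 5"
  shows "Legendre 5 (int p) = -1 \<longleftrightarrow> p mod 5 = 2 \<or> p mod 5 = 3"
proof -
  have "prime (5::nat)" by simp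
  then have "Legendre (int p) 5 * Legendre 5 (int p) = 1"
    using Quadratic_Reciprocity[of p 5] assms
    by (simp add: power_mult power2_eq_square flip: power_mult_distrib)
  then have "Legendre 5 (int p) = -1 \<longleftrightarrow> Legendre (int p) 5 = -1"
    by (auto simp: zmult_eq_1_iff)
  also have "\<dots> \<longleftrightarrow> p mod 5 = 2 \<or> p mod 5 = 3"
    unfolding Legendre_mod_five_eq_minus_one_iff by presburger
  finally show ?thesis .
qed

lemma two_power_mod_five:
  "(2::nat) ^ n mod 5 = 2 ^ (n mod 4) mod 5"
proof -
  have "(2::nat) ^ n = 2 ^ (4 * (n div 4) + n mod 4)" by simp
  also have "\<dots> = (2 ^ 4) ^ (n div 4) * 2 ^ (n mod 4)"
    by (simp only: power_add power_mult)
  also have "[\<dots> = 1 ^ (n div 4) * 2 ^ (n mod 4)] (mod 5)"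
    by (intro cong_mult cong_pow) (auto simp: cong_def)
  finally show ?thesis by (simp add: cong_def)
qed

text \<open>
  Replacing \<open>3\<close> by \<open>2 ^ 3\<close> gives the exponent \<open>a + 3 * b\<close>, a natural number that is congruent to
  the possibly negative \<open>a - b\<close> modulo \<open>4\<close>.
\<close>
lemma two_three_power_mod_five_iff:
  "(2 ^ a * 3 ^ b :: nat) mod 5 \<in> {2, 4} \<longleftrightarrow> (int a - int b) mod 4 \<in> {1, 2}"
proof -
  have "[3 = 2 ^ 3] (mod 5::nat)" by (simp add: cong_def)
  then have "[2 ^ a * 3 ^ b = 2 ^ a * (2 ^ 3) ^ b] (mod 5::nat)"
    by (intro cong_mult cong_pow cong_refl)
  then have "(2 ^ a * 3 ^ b :: nat) mod 5 = 2 ^ ((a + 3 * b) mod 4) mod 5"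
    using two_power_mod_five[of "a + 3 * b"]
    by (simp only: cong_def power_mult power_add)
  moreover have "(2::nat) ^ (n mod 4) mod 5 \<in> {2, 4} \<longleftrightarrow> n mod 4 \<in> {1, 2}" for n
  proof -
    have "n mod 4 \<in> {0, 1, 2, 3}" by auto
    then show ?thesis by auto
  qed
  moreover have "(a + 3 * b) mod 4 \<in> {1, 2} \<longleftrightarrow> (int a - int b) mod 4 \<in> {1, 2}"
    by simp presburger
  ultimately show ?thesis by simp
qed

theorem theorem4p1:
  fixes a b m p :: nat
  assumes "a \<ge> 1" and "b \<ge> 1"
    and "m = pock_m a b"
    and "p = pock_p a b"
    and "prime p"
  shows "(valid_pocklington_witness p 2 5 \<longleftrightarrow> [m = 1] (mod 5) \<or> [m = 3] (mod 5))
    \<and> ([m = 1] (mod 5) \<or> [m = 3] (mod 5)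
        \<longleftrightarrow> [int a - int b = 1] (mod 4) \<or> [int a - int b = 2] (mod 4))"
proof -
  have p: "p = 3 * m * (m + 1) + 1"
    using assms(3,4) by (simp add: pock_p_def)
  have "(2::nat) ^ 1 * 3 ^ 1 \<le> 2 ^ a * 3 ^ b"
    using assms(1,2) by (intro mult_le_mono power_increasing) auto
  then have m: "m + 1 = 2 ^ a * 3 ^ b" and "m \<ge> 5"
    using assms(3) by (auto simp: pock_m_def)
  have "3 * m * 1 \<le> 3 * m * (m + 1)" by (intro mult_le_mono2) simp
  with \<open>m \<ge> 5\<close> have "p > 5" unfolding p by linarith
  have "[p = 3 * (m mod 5) * (m mod 5 + 1) + 1] (mod 5)"
    unfolding p by (intro cong_add cong_mult cong_refl) (simp_all add: cong_def)
  then have "p mod 5 = (3 * (m mod 5) * (m mod 5 + 1) + 1) mod 5"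
    by (simp only: cong_def)
  moreover have "m mod 5 \<in> {0, 1, 2, 3, 4}" by auto
  ultimately have "p mod 5 = 2 \<or> p mod 5 = 3 \<longleftrightarrow> m mod 5 = 1 \<or> m mod 5 = 3"
    by auto
  then have "valid_pocklington_witness p 2 5 \<longleftrightarrow> [m = 1] (mod 5) \<or> [m = 3] (mod 5)"
    using valid_witness_two_iff_Legendre[OF assms(5)]
      Legendre_five_eq_minus_one_iff[OF assms(5)] \<open>p > 5\<close>
    by (simp add: cong_def)
  moreover have "m mod 5 = 1 \<or> m mod 5 = 3 \<longleftrightarrow> (m + 1) mod 5 \<in> {2, 4}"
    by simp presburger
  then have "[m = 1] (mod 5) \<or> [m = 3] (mod 5)
      \<longleftrightarrow> [int a - int b = 1] (mod 4) \<or> [int a - int b = 2] (mod 4)"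
    unfolding m two_three_power_mod_five_iff by (simp add: cong_def)
  ultimately show ?thesis by blast
qed

end
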